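(* Let $n \geq 3$, $r \geq 2$ and $0\le \ell < d \leq \left\lfloor \frac{n+\ell-1}{2} \right\rfloor$ be integers. Suppose that $G$ is an $n$-vertex graph that is not $\ell$-hamiltonian, with minimum degree $\delta(G) \geq d$, such that $$N(G, K_r) > \max\left\{ h_r(n,d+1,\ell),\; h_r\left(n, \left\lfloor \tfrac{n+\ell-1}{2}\right\rfloor, \ell\right)\right\}.$$ Then $G$ is (isomorphic to) a subgraph of either $H_{n,d,\ell}$ or $H'_{n,d,\ell}$.
   Context: All graphs are finite and simple. A linear forest is a graph that is a vertex-disjoint union of paths. For an integer $\ell\ge 0$, a graph $G$ is called $\ell$-hamiltonian if for every linear forest $F$ with exactly $\ell$ edges contained in $G$, $G$ has a hamiltonian cycle containing all edges of $F$ (so $0$-hamiltonian means hamiltonian). $N(G,K_r)$ denotes the number of copies of the complete graph $K_r$ in $G$ (i.e. the number of $r$-element vertex subsets inducing a clique). For integers $0\le \ell<d\le \lfloor (n+\ell-1)/2\rfloor$: - $H_{n,d,\ell}$ is the $n$-vertex graph obtained from a copy of $K_{n-d+\ell}$ with vertex set $A$ by adding $d-\ell$ new vertices, each of degree $d$ and each adjacent to exactly the vertices of one common fixed set $B\subseteq A$ with $|B|=d$ (the new vertices are pairwise non-adjacent). - $H'_{n,d,\ell}$ is the $n$-vertex graph obtained from a copy of $K_{n-d+\ell}$ and a copy of $K_{d+1}$ by identifying $\ell+1$ vertices (i.e. it is the union of a clique on $n-d+\ell$ vertices and a clique on $d+1$ vertices sharing exactly $\ell+1$ vertices). The function $h_r$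 is given by the formula $h_r(n,d,\ell) = \binom{n-d+\ell}{r} + (d-\ell)\binom{d}{r-1}$ (the number of copies of $K_r$ in $H_{n,d,\ell}$ when $0\le \ell<d\le \lfloor (n+\ell-1)/2\rfloor$; the formula is used also for the value $d+1$). *)

theory Defs
  imports Main "HOL-Library.Ramsey"
begin

text \<open>A graph is a pair of a vertex set and an edge set, edges being two-element vertex sets.\<close>

type_synonym 'a graph = "'a set \<times> 'a set set"

abbreviation verts :: "'a graph \<Rightarrow> 'a set" where "verts \<equiv> fst"
abbreviation edges :: "'a graph \<Rightarrow> 'a set set" where "edges \<equiv> snd"

definition simple_graph :: "'a graph \<Rightarrow> bool" where
  "simple_graph G \<longleftrightarrow> finite (verts G) \<and> edges G \<subseteq> [verts G]\<^bsup>2\<^esup>"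

definition subgraph :: "'a graph \<Rightarrow> 'a graph \<Rightarrow> bool" where
  "subgraph H G \<longleftrightarrow> verts H \<subseteq> verts G \<and> edges H \<subseteq> edges G"

definition iso_to_subgraph :: "'a graph \<Rightarrow> 'b graph \<Rightarrow> bool" where
  "iso_to_subgraph G H \<longleftrightarrow>
     (\<exists>f. inj_on f (verts G) \<and> subgraph (f ` verts G, (\<lambda>e. f ` e) ` edges G) H)"

definition degree :: "'a graph \<Rightarrow> 'a \<Rightarrow> nat" where
  "degree G v = card {e \<in> edges G. v \<in> e}"

definition min_degree :: "'a graph \<Rightarrow> nat" where
  "min_degree G = Min (degree G ` verts G)"

definition num_cliques :: "'a graph \<Rightarrow> nat \<Rightarrow> nat" where
  "num_cliques G r = card {S \<in> [verts G]\<^bsup>r\<^esup>. clique S (edges G)}"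

definition path_edges :: "'a list \<Rightarrow> 'a set set" where
  "path_edges xs = {{xs ! i, xs ! Suc i} | i. Suc i < length xs}"

text \<open>A path may consist of a single vertex.\<close>

definition is_path :: "'a graph \<Rightarrow> bool" where
  "is_path P \<longleftrightarrow> (\<exists>xs. xs \<noteq> [] \<and> distinct xs \<and> P = (set xs, path_edges xs))"

definition is_cycle :: "'a graph \<Rightarrow> bool" where
  "is_cycle C \<longleftrightarrow> (\<exists>xs. 3 \<le> length xs \<and> distinct xs \<and>
     C = (set xs, insert {last xs, hd xs} (path_edges xs)))"

definition linear_forest :: "'a graph \<Rightarrow> bool" where
  "linear_forest F \<longleftrightarrow> finite (verts F) \<and>
     (\<exists>\<P>. (\<forall>P\<in>\<P>. is_path P) \<and> pairwise (\<lambda>P Q. disjnt (verts P) (verts Q)) \<P> \<and>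
          F = (\<Union>(verts ` \<P>), \<Union>(edges ` \<P>)))"

definition hamiltonian_cycle :: "'a graph \<Rightarrow> 'a graph \<Rightarrow> bool" where
  "hamiltonian_cycle G C \<longleftrightarrow> is_cycle C \<and> subgraph C G \<and> verts C = verts G"

definition l_hamiltonian :: "nat \<Rightarrow> 'a graph \<Rightarrow> bool" where
  "l_hamiltonian l G \<longleftrightarrow>
     (\<forall>F. linear_forest F \<and> subgraph F G \<and> card (edges F) = l \<longrightarrow>
          (\<exists>C. hamiltonian_cycle G C \<and> edges F \<subseteq> edges C))"

text \<open>
  Both extremal graphs live on the vertices \<open>0, \<dots>, n - 1\<close>, for
  \<open>l < d \<le> (n + l - 1) div 2\<close>; the big clique is on the first \<open>n - d + l\<close> of them.
  In \<open>H_graph\<close>, the set \<open>B\<close> of common neighbours of the other \<open>d - l\<close> vertices is \<open>{..<d}\<close>.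
  In \<open>H'_graph\<close>, the second clique is on the last \<open>d + 1\<close> vertices, so that the
  two cliques share \<open>(n - d + l) - (n - d - 1) = l + 1\<close> vertices.
\<close>

definition H_graph :: "nat \<Rightarrow> nat \<Rightarrow> nat \<Rightarrow> nat graph" where
  "H_graph n d l =
     ({..<n}, [{..<n - d + l}]\<^bsup>2\<^esup> \<union> {{u, v} | u v. u \<in> {..<d} \<and> v \<in> {n - d + l..<n}})"

definition H'_graph :: "nat \<Rightarrow> nat \<Rightarrow> nat \<Rightarrow> nat graph" where
  "H'_graph n d l = ({..<n}, [{..<n - d + l}]\<^bsup>2\<^esup> \<union> [{n - d - 1..<n}]\<^bsup>2\<^esup>)"

definition h :: "nat \<Rightarrow> nat \<Rightarrow> nat \<Rightarrow> nat \<Rightarrow> nat" where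
  "h r n d l = ((n - d + l) choose r) + (d - l) * (d choose (r - 1))"

end

theory Submission
  imports Defs
begin

text \<open>
  Fix a linear forest \<open>F\<close> with \<open>l\<close> edges that lies on no hamiltonian cycle
  of \<open>G\<close>, and add edges to \<open>G\<close> as long as this remains so. Non-adjacent
  vertices then are the ends of a hamiltonian path through \<open>F\<close>, and Ore's crossing
  argument bounds their degree sum by \<open>n - 1 + l\<close>. A non-adjacent pair of maximal
  degree sum, among the vertices of degree at least some \<open>t\<close>, hence yields some
  \<open>k \<ge> t\<close> with at least \<open>k - l\<close> vertices of degree at most
  \<open>k\<close>, so that there are at most \<open>h r n k l\<close> cliques of size
  \<open>r\<close>. As \<open>h\<close> is convex in \<open>k\<close>, the hypothesis excludes
  \<open>k > d\<close>. So exactly \<open>d - l\<close> vertices, forming a set \<open>D\<close>,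
  have degree \<open>d\<close>, and all the others form a clique. By the degree sum bound, each
  vertex outside \<open>D\<close> is adjacent to all of \<open>D\<close> or to none of it; let
  \<open>B\<close> consist of the former. If \<open>D\<close> is a clique, \<open>G\<close> lies in
  \<open>H'_graph n d l\<close>. Otherwise, a crossing argument on a hamiltonian path between
  non-adjacent vertices of \<open>D\<close>, chosen to have as many edges as possible outside
  \<open>B \<union> D\<close>, shows \<open>card B \<ge> d\<close>, and \<open>G\<close> lies in
  \<open>H_graph n d l\<close>.
\<close>

section \<open>Edge sets of vertex lists read as paths and as cycles\<close>

lemma path_edges_Nil [simp]: "path_edges [] = {}"
  by (simp add: path_edges_def)

lemma path_edges_single [simp]: "path_edges [x] = {}"
  by (simp add: path_edges_def)

lemma path_edges_Cons_Cons [simp]: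
  "path_edges (x # y # zs) = insert {x, y} (path_edges (y # zs))"
proof -
  have "{{(x # y # zs) ! i, (x # y # zs) ! Suc i} | i. Suc i < length (x # y # zs)} =
    insert {x, y} {{(y # zs) ! i, (y # zs) ! Suc i} | i. Suc i < length (y # zs)}"
    (is "?A = insert _ ?B")
  proof (intro equalityI subsetI)
    fix e assume "e \<in> ?A"
    then obtain i where i: "e = {(x # y # zs) ! i, (x # y # zs) ! Suc i}"
      "Suc i < length (x # y # zs)" by blast
    show "e \<in> insert {x, y} ?B"
    proof (cases i)
      case 0
      then show ?thesis using i by simp
    next
      case (Suc j)
      then have "e = {(y # zs) ! j, (y # zs) ! Suc j}" "Suc j < length (y # zs)"
        using i by auto
      then show ?thesis by blast
    qed
  next
    fix e assume "e \<in> insert {x, y} ?B"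
    then consider "e = {x, y}" | i where "e = {(y # zs) ! i, (y # zs) ! Suc i}" "Suc i < length (y # zs)"
      by blast
    then show "e \<in> ?A"
    proof cases
      case 1
      then have "e = {(x # y # zs) ! 0, (x # y # zs) ! Suc 0}" "Suc 0 < length (x # y # zs)" by auto
      then show ?thesis by blast
    next
      case 2
      then have "e = {(x # y # zs) ! Suc i, (x # y # zs) ! Suc (Suc i)}"
        "Suc (Suc i) < length (x # y # zs)" by auto
      then show ?thesis by blast
    qed
  qed
  then show ?thesis by (simp only: path_edges_def)
qed

lemma path_edges_append:
  "xs \<noteq> [] \<Longrightarrow> ys \<noteq> [] \<Longrightarrow>
    path_edges (xs @ ys) = insert {last xs, hd ys} (path_edges xs \<union> path_edges ys)"
proof (induction xs)
  case (Cons x xs)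
  then show ?case by (cases xs; cases ys) auto
qed simp

lemma path_edges_append_subset: "path_edges xs \<union> path_edges ys \<subseteq> path_edges (xs @ ys)"
  by (cases "xs = []"; cases "ys = []") (auto simp: path_edges_append)

lemma path_edges_rev [simp]: "path_edges (rev xs) = path_edges xs"
proof (induction xs)
  case (Cons x xs)
  then show ?case
  proof (cases xs)
    case (Cons y ys)
    have "path_edges (rev (x # xs)) = insert {y, x} (path_edges (rev xs))"
      using Cons path_edges_append[of "rev xs" "[x]"] by simp
    then show ?thesis using Cons.IH Cons by (simp add: insert_commute)
  qed simp
qed simp

lemma finite_path_edges [simp]: "finite (path_edges xs)"
  unfolding path_edges_def by (rule finite_subset[of _ "(\<lambda>i. {xs ! i, xs ! Suc i}) ` {..<length xs}"]) auto

text \<open>Lets path edges be counted by their positions, so that the number of forest edges bounds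
  a number of indices.\<close>

lemma inj_on_path_edge:
  assumes "distinct xs"
  shows "inj_on (\<lambda>i. {xs ! i, xs ! Suc i}) {i. Suc i < length xs}"
proof (rule inj_onI)
  fix i j assume "i \<in> {i. Suc i < length xs}" "j \<in> {i. Suc i < length xs}"
    and eq: "{xs ! i, xs ! Suc i} = {xs ! j, xs ! Suc j}"
  then have "Suc i < length xs" "Suc j < length xs" by auto
  then show "i = j" using eq nth_eq_iff_index_eq[OF assms]
    by (auto simp: doubleton_eq_iff)
qed

text \<open>Used contrapositively: a chord between positions that are not consecutive is no edge of
  the path.\<close>

lemma nth_path_edgeD:
  assumes "distinct xs" "a < b" "b < length xs" "{xs ! a, xs ! b} \<in> path_edges xs"
  shows "b = Suc a"
proof -
  obtain k where k: "Suc k < length xs" "{xs ! a, xs ! b} = {xs ! k, xs ! Suc k}"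
    using assms(4) by (auto simp: path_edges_def)
  then have "a = k \<and> b = Suc k \<or> a = Suc k \<and> b = k"
    using assms(2,3) nth_eq_iff_index_eq[OF assms(1)] unfolding doubleton_eq_iff by auto
  then show ?thesis using assms(2) by auto
qed

lemma path_edges_subset_nsets:
  assumes "distinct xs"
  shows "path_edges xs \<subseteq> [set xs]\<^bsup>2\<^esup>"
  using assms by (auto simp: path_edges_def nsets_def card_insert_if nth_eq_iff_index_eq)

definition cycle_edges :: "'a list \<Rightarrow> 'a set set" where
  "cycle_edges xs = insert {last xs, hd xs} (path_edges xs)"

lemma cycle_edges_append:
  "xs \<noteq> [] \<Longrightarrow> ys \<noteq> [] \<Longrightarrow>
    cycle_edges (xs @ ys) = insert {last ys, hd xs} (insert {last xs, hd ys} (path_edges xs \<union> path_edges ys))"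
  by (simp add: cycle_edges_def path_edges_append)

lemma cycle_edges_subset_nsets:
  assumes "distinct xs" "2 \<le> length xs"
  shows "cycle_edges xs \<subseteq> [set xs]\<^bsup>2\<^esup>"
proof -
  have "xs \<noteq> []" using assms by auto
  moreover have "last xs \<noteq> hd xs"
    using assms by (cases xs) auto
  ultimately show ?thesis
    using path_edges_subset_nsets[OF assms(1)] by (auto simp: cycle_edges_def nsets_def)
qed

lemma split_at_edge:
  assumes "Suc i < length xs"
  obtains p q where "xs = p @ q" "p \<noteq> []" "q \<noteq> []" "last p = xs ! i" "hd q = xs ! Suc i"
    "length p = Suc i"
proof
  show "xs = take (Suc i) xs @ drop (Suc i) xs" by simp
  show "last (take (Suc i) xs) = xs ! i" using assms by (simp add: take_Suc_conv_app_nth)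
  show "hd (drop (Suc i) xs) = xs ! Suc i" using assms by (simp add: hd_drop_conv_nth)
qed (use assms in auto)

text \<open>Rotating the list moves the given edge to the closing position, and a reversal corrects
  its direction. Dropping the edge then leaves a path from \<open>u\<close> to
  \<open>v\<close>.\<close>

lemma cycle_edge_as_path_ends:
  assumes "distinct xs" "xs \<noteq> []" "{u, v} \<in> cycle_edges xs" "u \<noteq> v"
  obtains ys where "distinct ys" "set ys = set xs" "length ys = length xs"
    "cycle_edges ys = cycle_edges xs" "hd ys = u" "last ys = v"
proof -
  have "\<exists>ys. distinct ys \<and> set ys = set xs \<and> length ys = length xs \<and>
      cycle_edges ys = cycle_edges xs \<and> {u, v} = {last ys, hd ys}"
  proof (cases "{u, v} = {last xs, hd xs}")
    case True
    then show ?thesis using assms by blast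
  next
    case False
    then obtain i where i: "Suc i < length xs" "{u, v} = {xs ! i, xs ! Suc i}"
      using assms(3) by (auto simp: cycle_edges_def path_edges_def)
    then obtain p q where pq: "xs = p @ q" "p \<noteq> []" "q \<noteq> []" "last p = xs ! i" "hd q = xs ! Suc i"
      using split_at_edge[of i xs] by metis
    have "cycle_edges (q @ p) = cycle_edges xs"
      using pq(2,3) unfolding pq(1) by (auto simp: cycle_edges_append)
    moreover have "{u, v} = {last (q @ p), hd (q @ p)}"
      using pq(2-5) i(2) by simp
    moreover have "distinct (q @ p)" "set (q @ p) = set xs" "length (q @ p) = length xs"
      using assms(1) unfolding pq(1) by auto
    ultimately show ?thesis by blast
  qed
  then obtain ys where ys: "distinct ys" "set ys = set xs" "length ys = length xs"
      "cycle_edges ys = cycle_edges xs" "{u, v} = {last ys, hd ys}" by blast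
  have "ys \<noteq> []" using ys(3) assms(2) by auto
  show ?thesis
  proof (cases "hd ys = u")
    case True
    then have "last ys = v" using ys(5) by (auto simp: doubleton_eq_iff)
    then show ?thesis using ys(1-4) True that by blast
  next
    case False
    then have "hd ys = v" "last ys = u" using ys(5) by (auto simp: doubleton_eq_iff)
    moreover have "cycle_edges (rev ys) = cycle_edges ys"
      using \<open>ys \<noteq> []\<close> by (simp add: cycle_edges_def hd_rev last_rev insert_commute)
    ultimately show ?thesis using ys(1-4) \<open>ys \<noteq> []\<close>
      by (intro that[of "rev ys"]) (simp_all add: hd_rev last_rev)
  qed
qed

text \<open>With \<open>xs = p @ s @ t\<close>, the list \<open>p @ rev s @ t\<close> trades the two
  edges at the ends of \<open>s\<close> for two chords. The upper bound on its edges keeps it inside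
  the graph, the lower bound keeps the forest edges and records the gain.\<close>

lemma reverse_segment:
  assumes "distinct xs" "i < j" "Suc j < length xs"
  obtains ys where "distinct ys" "set ys = set xs" "hd ys = hd xs" "last ys = last xs"
    "path_edges ys \<subseteq> path_edges xs \<union> {{xs ! i, xs ! j}, {xs ! Suc i, xs ! Suc j}}"
    "path_edges xs - {{xs ! i, xs ! Suc i}, {xs ! j, xs ! Suc j}} \<union>
      {{xs ! i, xs ! j}, {xs ! Suc i, xs ! Suc j}} \<subseteq> path_edges ys"
proof -
  obtain p q where pq: "xs = p @ q" "p \<noteq> []" "q \<noteq> []" "last p = xs ! i" "hd q = xs ! Suc i"
      "length p = Suc i"
    using assms split_at_edge[of i xs] by (metis Suc_lessD less_trans_Suc)
  have jq: "Suc (j - Suc i) < length q" using pq assms by auto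
  have q1: "q ! (j - Suc i) = xs ! j" "q ! Suc (j - Suc i) = xs ! Suc j"
    using pq(1,6) assms(2) by (auto simp: nth_append Suc_diff_Suc)
  obtain s t where st: "q = s @ t" "s \<noteq> []" "t \<noteq> []" "last s = xs ! j" "hd t = xs ! Suc j"
    using split_at_edge[OF jq] q1 by metis
  have hs: "hd s = xs ! Suc i" using pq st by simp
  have xs: "xs = p @ s @ t" using pq st by simp
  have px: "path_edges (p @ s @ t) = {{xs ! i, xs ! Suc i}, {xs ! j, xs ! Suc j}} \<union> path_edges p \<union> path_edges s \<union> path_edges t"
    using pq(2,4) st(2-5) hs by (simp add: path_edges_append) blast
  have py: "path_edges (p @ rev s @ t) = {{xs ! i, xs ! j}, {xs ! Suc i, xs ! Suc j}} \<union> path_edges p \<union> path_edges s \<union> path_edges t"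
    using pq(2,4) st(2-5) hs by (simp add: path_edges_append hd_rev last_rev) blast
  show ?thesis
  proof (rule that[of "p @ rev s @ t"])
    show "distinct (p @ rev s @ t)" "set (p @ rev s @ t) = set xs"
      "hd (p @ rev s @ t) = hd xs" "last (p @ rev s @ t) = last xs"
      using assms(1) xs pq(2) st(3) by auto
  qed (auto simp: px[folded xs] py)
qed

text \<open>The component paths are concatenated in any order and the uncovered vertices appended;
  the joining pairs need not be edges of a given graph. In a complete graph on at least three
  vertices the list closes to a hamiltonian cycle through the forest.\<close>

lemma linear_forest_in_path:
  assumes "linear_forest F" "verts F \<subseteq> V" "finite V"
  obtains xs where "distinct xs" "set xs = V" "edges F \<subseteq> path_edges xs"
proof -
  obtain \<P> where P: "\<forall>P\<in>\<P>. is_path P" "pairwise (\<lambda>P Q. disjnt (verts P) (verts Q)) \<P>"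
    "F = (\<Union>(verts ` \<P>), \<Union>(edges ` \<P>))" using assms(1) by (auto simp: linear_forest_def)
  \<comment> \<open>The family is finite because its members have nonempty, pairwise disjoint vertex
    sets, which embeds it into \<open>Pow V\<close>.\<close>
  have "inj_on verts \<P>"
  proof (rule inj_onI)
    fix P Q assume PQ: "P \<in> \<P>" "Q \<in> \<P>" "verts P = verts Q"
    moreover have "verts P \<noteq> {}" using P(1) PQ by (auto simp: is_path_def)
    ultimately show "P = Q" using P(2) by (auto simp: pairwise_def disjnt_def)
  qed
  moreover have "finite (verts ` \<P>)"
    using assms(2,3) P(3) by (intro finite_subset[of "verts ` \<P>" "Pow V"]) auto
  ultimately have "finite \<P>" using finite_imageD by blast
  then have "\<exists>xs. distinct xs \<and> set xs = \<Union>(verts ` \<P>) \<and> \<Union>(edges ` \<P>) \<subseteq> path_edges xs"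
    using P(1,2)
  proof (induction \<P>)
    case (insert P \<P>)
    then obtain xs where xs: "distinct xs" "set xs = \<Union>(verts ` \<P>)" "\<Union>(edges ` \<P>) \<subseteq> path_edges xs"
      by (auto simp: pairwise_insert)
    obtain ys where ys: "distinct ys" "P = (set ys, path_edges ys)"
      using insert.prems by (auto simp: is_path_def)
    have "disjnt (verts P) (verts Q)" if "Q \<in> \<P>" for Q
      using insert.prems(2) insert.hyps(2) that by (metis insertI1 insertI2 pairwiseD)
    then have "set ys \<inter> set xs = {}"
      unfolding xs(2) by (fastforce simp: ys(2) disjnt_def)
    then show ?case using xs ys path_edges_append_subset[of ys xs]
      by (intro exI[of _ "ys @ xs"]) auto
  qed simp
  then obtain xs where xs: "distinct xs" "set xs = verts F" "edges F \<subseteq> path_edges xs"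
    using P(3) by auto
  obtain zs where zs: "set zs = V - verts F" "distinct zs"
    using finite_distinct_list[of "V - verts F"] assms(3) by auto
  show ?thesis
    using xs zs assms(2) path_edges_append_subset[of xs zs] by (intro that[of "xs @ zs"]) auto
qed

section \<open>Neighbourhoods, clique counts and the convexity of \<open>h\<close>\<close>

definition nbrs :: "'a set set \<Rightarrow> 'a \<Rightarrow> 'a set" where
  "nbrs E v = {w. {v, w} \<in> E}"

lemma nbrs_subset: "E \<subseteq> [V]\<^bsup>2\<^esup> \<Longrightarrow> nbrs E v \<subseteq> V - {v}"
  by (auto simp: nbrs_def nsets_def)

lemma degree_eq_card_nbrs:
  assumes "E \<subseteq> [V]\<^bsup>2\<^esup>"
  shows "degree (V, E) v = card (nbrs E v)"
proof -
  have "bij_betw (\<lambda>w. {v, w}) (nbrs E v) {e \<in> E. v \<in> e}"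
    unfolding bij_betw_def
  proof
    show "inj_on (\<lambda>w. {v, w}) (nbrs E v)"
      by (auto simp: inj_on_def doubleton_eq_iff)
    have "\<exists>w. e = {v, w}" if "e \<in> E" "v \<in> e" for e
      using assms that by (auto simp: nsets_def card_2_iff)
    then show "(\<lambda>w. {v, w}) ` nbrs E v = {e \<in> E. v \<in> e}"
      by (auto simp: nbrs_def image_iff)
  qed
  then show ?thesis by (auto simp: degree_def dest: bij_betw_same_card)
qed

lemma num_cliques_mono:
  assumes "finite V" "E \<subseteq> E'"
  shows "num_cliques (V, E) r \<le> num_cliques (V, E') r"
  unfolding num_cliques_def using assms
  by (intro card_mono) (auto simp: finite_imp_finite_nsets clique_def)

text \<open>Choose exactly \<open>k - l\<close> vertices \<open>D'\<close> of \<open>D\<close>. A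
  clique either avoids \<open>D'\<close>, so lies among \<open>n - k + l\<close> vertices, or
  consists of some \<open>v\<close> in \<open>D'\<close> and \<open>r - 1\<close> of its at most
  \<open>k\<close> neighbours.\<close>

lemma num_cliques_le_h:
  assumes V: "finite V" "E \<subseteq> [V]\<^bsup>2\<^esup>" "card V = n"
    and D: "D \<subseteq> V" "k \<le> card D + l" "\<And>v. v \<in> D \<Longrightarrow> card (nbrs E v) \<le> k"
    and k: "l \<le> k" "k \<le> n"
  shows "num_cliques (V, E) r \<le> h r n k l"
proof -
  obtain D' where D': "D' \<subseteq> D" "card D' = k - l"
    using obtain_subset_with_card_n[of "k - l" D] D(2) by (metis le_diff_conv)
  have fin: "finite D'" "finite (nbrs E v)" for v
    using V D(1) D'(1) nbrs_subset[OF V(2), of v] by (auto intro: finite_subset)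
  define X where "X v = insert v ` [nbrs E v]\<^bsup>(r - 1)\<^esup>" for v
  have "S \<in> [V - D']\<^bsup>r\<^esup> \<union> (\<Union>v\<in>D'. X v)" if S: "S \<in> [V]\<^bsup>r\<^esup>" "clique S E" for S
  proof (cases "S \<inter> D' = {}")
    case True
    then show ?thesis using S by (auto simp: nsets_def)
  next
    case False
    then obtain v where v: "v \<in> S" "v \<in> D'" by blast
    have "S - {v} \<in> [nbrs E v]\<^bsup>(r - 1)\<^esup>"
      using S v by (auto simp: nsets_def nbrs_def clique_def)
    then have "S \<in> X v" using v(1) by (auto simp: X_def image_iff intro!: bexI[of _ "S - {v}"])
    then show ?thesis using v(2) by blast
  qed
  then have "{S \<in> [V]\<^bsup>r\<^esup>. clique S E} \<subseteq> [V - D']\<^bsup>r\<^esup> \<union> (\<Union>v\<in>D'. X v)" by blast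
  moreover have finX: "finite (X v)" for v
    using fin by (simp add: X_def finite_imp_finite_nsets)
  ultimately have "num_cliques (V, E) r \<le> card ([V - D']\<^bsup>r\<^esup> \<union> (\<Union>v\<in>D'. X v))"
    unfolding num_cliques_def using V(1) fin(1)
    by (auto intro!: card_mono simp: finite_imp_finite_nsets)
  also have "\<dots> \<le> card ([V - D']\<^bsup>r\<^esup>) + card (\<Union>v\<in>D'. X v)"
    by (rule card_Un_le)
  also have "card (\<Union>v\<in>D'. X v) \<le> (\<Sum>v\<in>D'. card (X v))"
    using fin(1) by (rule card_UN_le)
  also have "\<dots> \<le> (\<Sum>v\<in>D'. k choose (r - 1))"
  proof (rule sum_mono)
    fix v assume "v \<in> D'"
    have "card (X v) \<le> card ([nbrs E v]\<^bsup>(r - 1)\<^esup>)"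
      unfolding X_def using fin(2) by (intro card_image_le finite_imp_finite_nsets)
    also have "\<dots> \<le> k choose (r - 1)"
      using \<open>v \<in> D'\<close> D' D(3) by (auto simp: card_nsets intro: binomial_right_mono)
    finally show "card (X v) \<le> k choose (r - 1)" .
  qed
  also have "card (V - D') = n - k + l"
    using V D(1) D' fin(1) k by (simp add: card_Diff_subset)
  then have "card ([V - D']\<^bsup>r\<^esup>) = (n - k + l) choose r" by simp
  finally show ?thesis by (simp add: h_def D'(2))
qed

text \<open>As the differences do not decrease, a negative one at \<open>k\<close> makes
  \<open>f\<close> fall all the way from \<open>a\<close> to \<open>k\<close>, and a nonnegative one
  makes it grow from \<open>k\<close> to \<open>b\<close>.\<close>

lemma convex_le_max:
  fixes f :: "nat \<Rightarrow> int"
  assumes "a \<le> k" "k \<le> b"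
    and conv: "\<And>i. a \<le> i \<Longrightarrow> Suc i < b \<Longrightarrow> f (Suc i) - f i \<le> f (Suc (Suc i)) - f (Suc i)"
  shows "f k \<le> max (f a) (f b)"
proof -
  have diff: "f (Suc i) - f i \<le> f (Suc j) - f j" if "i \<le> j" "a \<le> i" "j < b" for i j
    using that
  proof (induction j rule: dec_induct)
    case (step m)
    then show ?case using conv[of m] by linarith
  qed simp
  show ?thesis
  proof (cases "k < b \<and> f (Suc k) < f k")
    case True
    have "f j \<le> f a" if "a \<le> j" "j \<le> k" for j
      using that
    proof (induction j rule: dec_induct)
      case (step j)
      then show ?case using diff[of j k] True by simp
    qed simp
    then show ?thesis using assms(1) by (simp add: le_max_iff_disj)
  next
    case False
    have "f k \<le> f j" if "k \<le> j" "j \<le> b" for j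
      using that
    proof (induction j rule: dec_induct)
      case (step j)
      then show ?case using diff[of k j] False assms(1) by simp
    qed simp
    then show ?thesis using assms(2) by (simp add: le_max_iff_disj)
  qed
qed

text \<open>Pascal's rule in both summands gives the forward difference of \<open>h\<close>, with
  the negative term moved to the left to avoid truncated subtraction.\<close>

lemma h_Suc:
  assumes "2 \<le> r" "l \<le> k" "k < n"
  shows "h r n (Suc k) l + ((n - Suc k + l) choose (r - 1)) =
    h r n k l + (Suc k choose (r - 1)) + (k - l) * (k choose (r - 2))"
proof -
  obtain q where r: "r = Suc (Suc q)" using assms(1) by (metis add_2_eq_Suc le_Suc_ex)
  have "n - k + l = Suc (n - Suc k + l)" "Suc k - l = Suc (k - l)" using assms by auto
  then show ?thesis unfolding h_def r by (simp add: algebra_simps)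
qed

text \<open>In the forward difference the subtracted binomial decreases with \<open>k\<close> and
  the added terms increase, so \<open>h\<close> is convex. Differences are taken in the integers
  since they may be negative.\<close>

lemma h_le_max:
  assumes "2 \<le> r" "l \<le> a" "a \<le> k" "k \<le> b" "b \<le> n"
  shows "h r n k l \<le> max (h r n a l) (h r n b l)"
proof -
  have "int (h r n k l) \<le> max (int (h r n a l)) (int (h r n b l))"
  proof (rule convex_le_max[OF assms(3,4)])
    fix i assume i: "a \<le> i" "Suc i < b"
    have "(n - Suc (Suc i) + l) choose (r - 1) \<le> (n - Suc i + l) choose (r - 1)"
      by (rule binomial_right_mono) simp
    moreover have "Suc i choose (r - 1) \<le> Suc (Suc i) choose (r - 1)"
      by (rule binomial_right_mono) simp
    moreover have "(i - l) * (i choose (r - 2)) \<le> (Suc i - l) * (Suc i choose (r - 2))"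
      by (intro mult_mono binomial_right_mono) auto
    ultimately show "int (h r n (Suc i) l) - int (h r n i l)
        \<le> int (h r n (Suc (Suc i)) l) - int (h r n (Suc i) l)"
      using h_Suc[of r l i n] h_Suc[of r l "Suc i" n] assms i by linarith
  qed
  then show ?thesis by linarith
qed

text \<open>Supplies the numbering of vertex classes by consecutive blocks that the extremal graphs
  require.\<close>

lemma bij_to_intervals:
  assumes "finite A" "finite B" "finite C" "A \<inter> B = {}" "A \<inter> C = {}" "B \<inter> C = {}"
  obtains f :: "'a \<Rightarrow> nat" where "inj_on f (A \<union> B \<union> C)" "f ` A = {..<card A}"
    "f ` B = {card A..<card A + card B}" "f ` C = {card A + card B..<card A + card B + card C}"
proof -
  obtain f1 where f1: "bij_betw f1 A {..<card A}"
    using finite_same_card_bij[OF assms(1), of "{..<card A}"] by auto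
  obtain f2 where f2: "bij_betw f2 B {card A..<card A + card B}"
    using finite_same_card_bij[OF assms(2), of "{card A..<card A + card B}"] by auto
  obtain f3 where f3: "bij_betw f3 C {card A + card B..<card A + card B + card C}"
    using finite_same_card_bij[OF assms(3), of "{card A + card B..<card A + card B + card C}"] by auto
  define f where "f x = (if x \<in> A then f1 x else if x \<in> B then f2 x else f3 x)" for x
  have f: "bij_betw f A {..<card A}" "bij_betw f B {card A..<card A + card B}"
    "bij_betw f C {card A + card B..<card A + card B + card C}"
  proof -
    have "f x = f1 x" if "x \<in> A" for x using that by (simp add: f_def)
    then show "bij_betw f A {..<card A}" using f1 by (metis bij_betw_cong)
    have "f x = f2 x" if "x \<in> B" for x using that assms(4) by (auto simp: f_def)
    then show "bij_betw f B {card A..<card A + card B}" using f2 by (metis bij_betw_cong)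
    have "f x = f3 x" if "x \<in> C" for x using that assms(5,6) by (auto simp: f_def)
    then show "bij_betw f C {card A + card B..<card A + card B + card C}" using f3 by (metis bij_betw_cong)
  qed
  then have "bij_betw f (A \<union> B \<union> C) ({..<card A} \<union> {card A..<card A + card B}
      \<union> {card A + card B..<card A + card B + card C})"
    by (intro bij_betw_combine) auto
  then show ?thesis using f that by (auto simp: bij_betw_def)
qed

section \<open>Degree sums in graphs saturated with respect to a forest\<close>

lemma finite_positions [simp]: "finite {i. Suc i < n \<and> P i}"
  by (rule finite_subset[of _ "{..<n}"]) auto

text \<open>Records what edge-maximality provides: no hamiltonian cycle contains \<open>F\<close>,
  yet any missing edge would close a hamiltonian path through \<open>F\<close>.\<close>

locale forest_saturated =
  fixes V :: "'a set" and E F :: "'a set set"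
  assumes finite_V: "finite V" and edges_V: "E \<subseteq> [V]\<^bsup>2\<^esup>" and finite_F: "finite F"
    and no_cycle: "\<And>xs. distinct xs \<Longrightarrow> set xs = V \<Longrightarrow> cycle_edges xs \<subseteq> E \<Longrightarrow> \<not> F \<subseteq> cycle_edges xs"
    and path_if_nonadjacent: "\<And>u v. u \<in> V \<Longrightarrow> v \<in> V \<Longrightarrow> u \<noteq> v \<Longrightarrow> {u, v} \<notin> E \<Longrightarrow>
      \<exists>xs. distinct xs \<and> set xs = V \<and> path_edges xs \<subseteq> E \<and> F \<subseteq> path_edges xs \<and> hd xs = u \<and> last xs = v"
begin

abbreviation deg :: "'a \<Rightarrow> nat" where "deg v \<equiv> card (nbrs E v)"

definition spanning_path :: "'a list \<Rightarrow> bool" where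
  "spanning_path xs \<longleftrightarrow> xs \<noteq> [] \<and> distinct xs \<and> set xs = V \<and> path_edges xs \<subseteq> E \<and> F \<subseteq> path_edges xs"

lemma obtain_spanning_path:
  assumes "u \<in> V" "v \<in> V" "u \<noteq> v" "{u, v} \<notin> E"
  obtains xs where "spanning_path xs" "hd xs = u" "last xs = v"
proof -
  obtain xs where xs: "distinct xs" "set xs = V" "path_edges xs \<subseteq> E" "F \<subseteq> path_edges xs"
    "hd xs = u" "last xs = v"
    using path_if_nonadjacent[OF assms] by blast
  moreover have "xs \<noteq> []" using xs(2) assms(1) by auto
  ultimately show ?thesis using that by (simp add: spanning_path_def)
qed

lemma finite_nbrs [simp]: "finite (nbrs E v)"
  using nbrs_subset[OF edges_V, of v] finite_V by (auto intro: finite_subset)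

lemma spanning_path_length: "spanning_path xs \<Longrightarrow> length xs = card V"
  using distinct_card by (fastforce simp: spanning_path_def)

text \<open>Otherwise, with \<open>xs = p @ q\<close> split at that edge, the cycle
  \<open>rev p @ q\<close> replaces it by the two chords and still contains
  \<open>F\<close>.\<close>

lemma crossing_in_forest:
  assumes xs: "spanning_path xs" and i: "Suc i < length xs"
    and adj: "{hd xs, xs ! Suc i} \<in> E" "{last xs, xs ! i} \<in> E"
  shows "{xs ! i, xs ! Suc i} \<in> F"
proof (rule ccontr)
  assume nF: "{xs ! i, xs ! Suc i} \<notin> F"
  obtain p q where pq: "xs = p @ q" "p \<noteq> []" "q \<noteq> []" "last p = xs ! i" "hd q = xs ! Suc i"
    using split_at_edge[OF i] by metis
  have ends: "hd xs = hd p" "last xs = last q" using pq by auto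
  have px: "path_edges xs = insert {xs ! i, xs ! Suc i} (path_edges p \<union> path_edges q)"
    using path_edges_append[OF pq(2,3)] unfolding pq(4,5) unfolding pq(1)[symmetric] .
  have "cycle_edges (rev p @ q) =
      insert {last xs, xs ! i} (insert {hd xs, xs ! Suc i} (path_edges p \<union> path_edges q))"
    using cycle_edges_append[of "rev p" q] pq(2,3)
    unfolding ends by (simp add: hd_rev last_rev pq(4,5))
  moreover have "distinct (rev p @ q)" "set (rev p @ q) = V"
    using xs unfolding spanning_path_def pq(1) by auto
  ultimately show False
    using no_cycle[of "rev p @ q"] xs nF adj px unfolding spanning_path_def by auto
qed

text \<open>A neighbour of the first vertex is recorded one position before its own, while
  \<open>deg_last\<close> records neighbours of the last vertex at their own position. A position
  recorded by both is then a crossing.\<close>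

lemma deg_hd:
  assumes "spanning_path xs"
  shows "deg (hd xs) = card {i. Suc i < length xs \<and> {hd xs, xs ! Suc i} \<in> E}"
proof -
  have xs: "distinct xs" "set xs = V" "xs \<noteq> []" using assms by (auto simp: spanning_path_def)
  have "bij_betw (\<lambda>i. xs ! Suc i) {i. Suc i < length xs \<and> {hd xs, xs ! Suc i} \<in> E} (nbrs E (hd xs))"
    unfolding bij_betw_def
  proof
    show "inj_on (\<lambda>i. xs ! Suc i) {i. Suc i < length xs \<and> {hd xs, xs ! Suc i} \<in> E}"
      using xs(1) by (auto simp: inj_on_def nth_eq_iff_index_eq)
    have "\<exists>i. Suc i < length xs \<and> w = xs ! Suc i" if "w \<in> nbrs E (hd xs)" for w
    proof -
      have "w \<in> V" "w \<noteq> hd xs" using that nbrs_subset[OF edges_V] by blast+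
      then obtain j where "j < length xs" "w = xs ! j" "j \<noteq> 0"
        using xs by (metis hd_conv_nth in_set_conv_nth)
      then show ?thesis by (metis not0_implies_Suc)
    qed
    then show "(\<lambda>i. xs ! Suc i) ` {i. Suc i < length xs \<and> {hd xs, xs ! Suc i} \<in> E} = nbrs E (hd xs)"
      by (fastforce simp: nbrs_def image_iff)
  qed
  then show ?thesis by (auto dest: bij_betw_same_card)
qed

lemma deg_last:
  assumes "spanning_path xs"
  shows "deg (last xs) = card {i. Suc i < length xs \<and> {last xs, xs ! i} \<in> E}"
proof -
  have xs: "distinct xs" "set xs = V" "xs \<noteq> []" using assms by (auto simp: spanning_path_def)
  have "bij_betw (\<lambda>i. xs ! i) {i. Suc i < length xs \<and> {last xs, xs ! i} \<in> E} (nbrs E (last xs))"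
    unfolding bij_betw_def
  proof
    show "inj_on (\<lambda>i. xs ! i) {i. Suc i < length xs \<and> {last xs, xs ! i} \<in> E}"
      using xs(1) by (auto simp: inj_on_def nth_eq_iff_index_eq)
    have "\<exists>i. Suc i < length xs \<and> w = xs ! i" if "w \<in> nbrs E (last xs)" for w
    proof -
      have "w \<in> V" "w \<noteq> last xs" using that nbrs_subset[OF edges_V] by blast+
      then obtain j where "j < length xs" "w = xs ! j" "j \<noteq> length xs - 1"
        using xs by (metis last_conv_nth in_set_conv_nth)
      then have "Suc j < length xs" by simp
      then show ?thesis using \<open>w = xs ! j\<close> by blast
    qed
    then show "(\<lambda>i. xs ! i) ` {i. Suc i < length xs \<and> {last xs, xs ! i} \<in> E} = nbrs E (last xs)"
      by (fastforce simp: nbrs_def image_iff)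
  qed
  then show ?thesis by (auto dest: bij_betw_same_card)
qed

lemma card_forest_positions:
  assumes "spanning_path xs"
  shows "card {i. Suc i < length xs \<and> {xs ! i, xs ! Suc i} \<in> F} \<le> card F"
proof (rule card_inj_on_le[OF _ _ finite_F])
  show "inj_on (\<lambda>i. {xs ! i, xs ! Suc i}) {i. Suc i < length xs \<and> {xs ! i, xs ! Suc i} \<in> F}"
    using assms by (intro inj_on_subset[OF inj_on_path_edge]) (auto simp: spanning_path_def)
qed auto

text \<open>Both sets of recorded positions lie among the \<open>card V - 1\<close> path edges, and
  by the crossing argument they share at most \<open>card F\<close> of them.\<close>

lemma deg_sum_le:
  assumes "u \<in> V" "v \<in> V" "u \<noteq> v" "{u, v} \<notin> E"
  shows "deg u + deg v + 1 \<le> card V + card F"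
proof -
  obtain xs where xs: "spanning_path xs" "hd xs = u" "last xs = v"
    using obtain_spanning_path[OF assms] .
  define S T where "S = {i. Suc i < length xs \<and> {hd xs, xs ! Suc i} \<in> E}"
    and "T = {i. Suc i < length xs \<and> {last xs, xs ! i} \<in> E}"
  have fin: "finite S" "finite T" by (simp_all add: S_def T_def)
  have "card (S \<inter> T) \<le> card {i. Suc i < length xs \<and> {xs ! i, xs ! Suc i} \<in> F}"
    using crossing_in_forest[OF xs(1)] by (intro card_mono) (auto simp: S_def T_def)
  then have "card (S \<inter> T) \<le> card F" using card_forest_positions[OF xs(1)] by linarith
  moreover have "card (S \<union> T) \<le> card {..<card V - 1}"
    using spanning_path_length[OF xs(1)] by (intro card_mono) (auto simp: S_def T_def)
  moreover have "card V > 0" using assms(1) finite_V by (auto simp: card_gt_0_iff)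
  moreover have "deg u + deg v = card S + card T"
    using deg_hd[OF xs(1)] deg_last[OF xs(1)] xs by (simp add: S_def T_def)
  ultimately show ?thesis using card_Un_Int[OF fin] by simp
qed

text \<open>Take a non-adjacent pair with degrees at least \<open>t\<close>,
  \<open>deg x \<le> deg y\<close> and greatest degree sum, and put \<open>k = deg x\<close>. A
  non-neighbour of \<open>y\<close> with degree above \<open>k\<close> would give a better pair, and
  \<open>y\<close> has at least \<open>k - card F\<close> non-neighbours by
  \<open>deg_sum_le\<close>.\<close>

lemma many_low_degree_vertices:
  assumes "u \<in> V" "v \<in> V" "u \<noteq> v" "{u, v} \<notin> E" "t \<le> deg u" "t \<le> deg v"
  obtains k D where "t \<le> k" "2 * k + 1 \<le> card V + card F" "D \<subseteq> V" "k \<le> card D + card F"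
    "\<And>w. w \<in> D \<Longrightarrow> deg w \<le> k"
proof -
  define P where "P p \<longleftrightarrow> (case p of (x, y) \<Rightarrow> x \<in> V \<and> y \<in> V \<and> x \<noteq> y \<and> {x, y} \<notin> E \<and>
    t \<le> deg x \<and> t \<le> deg y \<and> deg x \<le> deg y)" for p
  have "P (if deg u \<le> deg v then (u, v) else (v, u))"
    using assms by (auto simp: P_def insert_commute)
  moreover have "\<forall>p. P p \<longrightarrow> (case p of (x, y) \<Rightarrow> deg x + deg y) < card V + card F"
    using deg_sum_le by (fastforce simp: P_def)
  ultimately obtain p where p: "P p"
    "\<forall>q. P q \<longrightarrow> (case q of (x, y) \<Rightarrow> deg x + deg y) \<le> (case p of (x, y) \<Rightarrow> deg x + deg y)"
    using ex_has_greatest_nat[of P _ "\<lambda>(x, y). deg x + deg y"] by blast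
  obtain x y where "p = (x, y)" by fastforce
  with p have xy: "P (x, y)" and max: "\<And>a b. P (a, b) \<Longrightarrow> deg a + deg b \<le> deg x + deg y"
    by auto
  have sum: "deg x + deg y + 1 \<le> card V + card F" using deg_sum_le xy by (simp add: P_def)
  define D where "D = V - insert y (nbrs E y)"
  show ?thesis
  proof (rule that[of "deg x" D])
    show "t \<le> deg x" using xy by (simp add: P_def)
    show "2 * deg x + 1 \<le> card V + card F" using sum xy by (simp add: P_def)
    have "y \<notin> nbrs E y" using nbrs_subset[OF edges_V] by blast
    then have "card D = card V - Suc (deg y)"
      using nbrs_subset[OF edges_V, of y] xy by (simp add: D_def card_Diff_subset P_def subset_iff)
    then show "deg x \<le> card D + card F" using sum by linarith
    fix w assume w: "w \<in> D"
    show "deg w \<le> deg x"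
    proof (rule ccontr)
      assume "\<not> deg w \<le> deg x"
      moreover have "{w, y} \<notin> E" "{y, w} \<notin> E" "w \<in> V" "w \<noteq> y"
        using w by (auto simp: D_def nbrs_def insert_commute)
      ultimately have "P (w, y) \<or> P (y, w)" using xy by (auto simp: P_def)
      then show False using max[of w y] max[of y w] \<open>\<not> deg w \<le> deg x\<close> by auto
    qed
  qed (auto simp: D_def)
qed

text \<open>
  Among the spanning paths from \<open>u\<close> to \<open>v\<close>, one with as many edges inside \<open>C\<close> as possible enters
  \<open>C\<close> at most once, and leaves it at most once, through an edge outside \<open>F\<close>. All other transitions use
  up edges of \<open>F\<close>, which improves the count behind the Ore-type bound on the degree sum.
\<close>

lemma deg_sum_clique_le:
  assumes uv: "u \<in> V" "v \<in> V" "u \<noteq> v" "{u, v} \<notin> E"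
    and C: "C \<subseteq> V" "C \<noteq> {}" "clique C E"
    and bdry: "clique {x \<in> V - C. \<exists>c\<in>C. {x, c} \<in> E} E"
    and away: "u \<notin> C" "v \<notin> C" "nbrs E u \<inter> C = {}" "nbrs E v \<inter> C = {}"
  shows "deg u + deg v + card C \<le> card V + card F"
proof -
  define Q where "Q xs \<longleftrightarrow> spanning_path xs \<and> hd xs = u \<and> last xs = v" for xs
  obtain zs where "Q zs" unfolding Q_def using obtain_spanning_path[OF uv] by metis
  moreover have "\<forall>xs. Q xs \<longrightarrow> card (path_edges xs \<inter> [C]\<^bsup>2\<^esup>) < Suc (card ([C]\<^bsup>2\<^esup>))"
    using finite_subset[OF C(1) finite_V]
    by (intro allI impI le_imp_less_Suc card_mono finite_imp_finite_nsets) auto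
  ultimately obtain xs where "Q xs"
    and max: "\<And>ys. Q ys \<Longrightarrow> card (path_edges ys \<inter> [C]\<^bsup>2\<^esup>) \<le> card (path_edges xs \<inter> [C]\<^bsup>2\<^esup>)"
    using ex_has_greatest_nat[of Q zs "\<lambda>xs. card (path_edges xs \<inter> [C]\<^bsup>2\<^esup>)"] by blast
  then have xs: "spanning_path xs" "hd xs = u" "last xs = v" by (auto simp: Q_def)
  then have xs': "distinct xs" "set xs = V" "xs \<noteq> []" "path_edges xs \<subseteq> E" "F \<subseteq> path_edges xs"
    by (auto simp: spanning_path_def)
  define m where "m = length xs"
  have m: "m = card V" unfolding m_def by (rule spanning_path_length[OF xs(1)])
  have "m > 0" unfolding m_def using xs'(3) by (rule length_greater_0_conv[THEN iffD2])
  have edge: "{xs ! i, xs ! Suc i} \<in> E" if "Suc i < m" for i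
    using xs'(4) that by (auto simp: path_edges_def m_def)
  have inV: "xs ! i \<in> V" if "i < m" for i using xs'(2) that by (auto simp: m_def)
  \<comment> \<open>A reversal that gains an edge inside \<open>C\<close> and gives up only edges
    outside \<open>F\<close> and not inside \<open>C\<close> contradicts the choice of
    \<open>xs\<close>.\<close>
  have no_swap: False if ij: "i < j" "Suc j < m" "j \<noteq> Suc i"
      and nF: "{xs ! i, xs ! Suc i} \<notin> F" "{xs ! j, xs ! Suc j} \<notin> F"
      and new: "{xs ! i, xs ! j} \<in> E" "{xs ! Suc i, xs ! Suc j} \<in> E"
      and nC: "{xs ! i, xs ! Suc i} \<notin> [C]\<^bsup>2\<^esup>" "{xs ! j, xs ! Suc j} \<notin> [C]\<^bsup>2\<^esup>"
      and gain: "{xs ! i, xs ! j} \<in> [C]\<^bsup>2\<^esup> \<or> {xs ! Suc i, xs ! Suc j} \<in> [C]\<^bsup>2\<^esup>" for i j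
  proof -
    obtain ys where ys: "distinct ys" "set ys = set xs" "hd ys = hd xs" "last ys = last xs"
      "path_edges ys \<subseteq> path_edges xs \<union> {{xs ! i, xs ! j}, {xs ! Suc i, xs ! Suc j}}"
      "path_edges xs - {{xs ! i, xs ! Suc i}, {xs ! j, xs ! Suc j}} \<union>
        {{xs ! i, xs ! j}, {xs ! Suc i, xs ! Suc j}} \<subseteq> path_edges ys"
      using reverse_segment[OF xs'(1) ij(1)] ij(2) unfolding m_def by blast
    have "ys \<noteq> []" using ys(2) xs'(3) by auto
    moreover have "path_edges ys \<subseteq> E" using ys(5) xs'(4) new by blast
    moreover have "F \<subseteq> path_edges ys" using ys(6) xs'(5) nF by blast
    ultimately have "Q ys"
      using ys(1-4) xs'(2) xs(2,3) by (simp add: Q_def spanning_path_def)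
    have notin: "{xs ! a, xs ! b} \<notin> path_edges xs" if ab: "Suc a < b" "b < m" for a b
      using nth_path_edgeD[OF xs'(1), of a b] ab by (auto simp: m_def)
    have "Suc i < j" using ij by simp
    then have "{xs ! i, xs ! j} \<notin> path_edges xs" "{xs ! Suc i, xs ! Suc j} \<notin> path_edges xs"
      using ij notin[of i j] notin[of "Suc i" "Suc j"] by auto
    then have "path_edges xs \<inter> [C]\<^bsup>2\<^esup> \<subset> path_edges ys \<inter> [C]\<^bsup>2\<^esup>"
      using gain nC ys(6) by blast
    then have "card (path_edges xs \<inter> [C]\<^bsup>2\<^esup>) < card (path_edges ys \<inter> [C]\<^bsup>2\<^esup>)"
      by (intro psubset_card_mono) auto
    then show False using max[OF \<open>Q ys\<close>] by simp
  qed
  \<comment> \<open>A position \<open>i\<close> stands for the path edge from \<open>xs ! i\<close>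
    to \<open>xs ! Suc i\<close>. \<open>S\<close> and \<open>T\<close> count the degrees of the
    ends, \<open>FI\<close> marks forest edges, and \<open>L\<close>, \<open>R\<close>,
    \<open>M\<close> mark edges entering, leaving and staying in \<open>C\<close>.\<close>
  define S T FI L R M where "S = {i. Suc i < m \<and> {hd xs, xs ! Suc i} \<in> E}"
    and "T = {i. Suc i < m \<and> {last xs, xs ! i} \<in> E}"
    and "FI = {i. Suc i < m \<and> {xs ! i, xs ! Suc i} \<in> F}"
    and "L = {i. Suc i < m \<and> xs ! i \<notin> C \<and> xs ! Suc i \<in> C}"
    and "R = {i. Suc i < m \<and> xs ! i \<in> C \<and> xs ! Suc i \<notin> C}"
    and "M = {i. Suc i < m \<and> xs ! i \<in> C \<and> xs ! Suc i \<in> C}"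
  note defs = S_def T_def FI_def L_def R_def M_def
  have fin: "finite S" "finite T" "finite FI" "finite L" "finite R" "finite M"
    by (simp_all add: defs)
  have nthne: "xs ! i \<noteq> xs ! j" if "i < j" "j < m" for i j
    using that nth_eq_iff_index_eq[OF xs'(1)] by (auto simp: m_def)
  have adj: "{x, y} \<in> E" if "x \<in> V - C" "y \<in> V - C" "x \<noteq> y" "{x, c} \<in> E" "{y, c'} \<in> E"
    "c \<in> C" "c' \<in> C" for x y c c'
    using bdry that unfolding clique_def by blast
  \<comment> \<open>Two entries outside \<open>F\<close> could be swapped: their outer ends are
    adjacent by \<open>bdry\<close>, their inner ends form a new path edge inside the clique
    \<open>C\<close>.\<close>
  have noL: False if "i \<in> L - FI" "j \<in> L - FI" "i < j" for i j
  proof (rule no_swap[OF that(3)])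
    have *: "Suc i < m" "Suc j < m" "xs ! i \<notin> C" "xs ! j \<notin> C" "xs ! Suc i \<in> C" "xs ! Suc j \<in> C"
      "xs ! i \<noteq> xs ! j" "xs ! Suc i \<noteq> xs ! Suc j"
      using that nthne by (auto simp: defs)
    show "{xs ! i, xs ! j} \<in> E"
      by (rule adj[of _ _ "xs ! Suc i" "xs ! Suc j"]) (use * edge inV in \<open>auto dest: Suc_lessD\<close>)
    show "{xs ! Suc i, xs ! Suc j} \<in> E" using C(3) * unfolding clique_def by blast
    show "{xs ! i, xs ! j} \<in> [C]\<^bsup>2\<^esup> \<or> {xs ! Suc i, xs ! Suc j} \<in> [C]\<^bsup>2\<^esup>"
      using * by (auto simp: nsets_def)
    show "j \<noteq> Suc i" using * by auto
  qed (use that in \<open>auto simp: defs nsets_def\<close>)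
  have noR: False if "i \<in> R - FI" "j \<in> R - FI" "i < j" for i j
  proof (rule no_swap[OF that(3)])
    have *: "Suc i < m" "Suc j < m" "xs ! i \<in> C" "xs ! j \<in> C" "xs ! Suc i \<notin> C" "xs ! Suc j \<notin> C"
      "xs ! i \<noteq> xs ! j" "xs ! Suc i \<noteq> xs ! Suc j"
      using that nthne by (auto simp: defs)
    have "{xs ! Suc i, xs ! i} \<in> E" "{xs ! Suc j, xs ! j} \<in> E"
      using * edge by (auto simp: insert_commute)
    then show "{xs ! Suc i, xs ! Suc j} \<in> E"
      using * inV adj[of _ _ "xs ! i" "xs ! j"] by blast
    show "{xs ! i, xs ! j} \<in> E" using C(3) * unfolding clique_def by blast
    show "{xs ! i, xs ! j} \<in> [C]\<^bsup>2\<^esup> \<or> {xs ! Suc i, xs ! Suc j} \<in> [C]\<^bsup>2\<^esup>"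
      using * by (auto simp: nsets_def)
    show "j \<noteq> Suc i" using * by auto
  qed (use that in \<open>auto simp: defs nsets_def\<close>)
  have "card (L - FI) \<le> 1"
    using noL fin(4) by (auto simp: card_le_Suc0_iff_eq) (metis DiffI linorder_neqE_nat)
  moreover have "card (R - FI) \<le> 1"
    using noR fin(5) by (auto simp: card_le_Suc0_iff_eq) (metis DiffI linorder_neqE_nat)
  moreover have "card L = card (L \<inter> FI) + card (L - FI)" "card R = card (R \<inter> FI) + card (R - FI)"
    using fin by (auto simp: card_Int_Diff)
  moreover have "card (S \<inter> T) + card (L \<inter> FI) + card (R \<inter> FI) \<le> card F"
  proof -
    \<comment> \<open>All three sets consist of forest positions. They are disjoint because the ends
      of the path have no neighbours in \<open>C\<close>, which keeps entries out of
      \<open>S\<close> and exits out of \<open>T\<close>.\<close>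
    have "S \<inter> T \<subseteq> FI"
      using crossing_in_forest[OF xs(1)] by (auto simp: defs m_def)
    moreover have "S \<inter> L = {}" "T \<inter> R = {}" "L \<inter> R = {}"
      using away(3,4) xs(2,3) by (auto simp: defs nbrs_def)
    ultimately have "card ((S \<inter> T) \<union> (L \<inter> FI) \<union> (R \<inter> FI)) = card (S \<inter> T) + card (L \<inter> FI) + card (R \<inter> FI)"
      using fin by (subst card_Un_disjoint; (subst card_Un_disjoint)?) auto
    moreover have "card ((S \<inter> T) \<union> (L \<inter> FI) \<union> (R \<inter> FI)) \<le> card FI"
      using \<open>S \<inter> T \<subseteq> FI\<close> fin by (intro card_mono) auto
    ultimately show ?thesis
      using card_forest_positions[OF xs(1)] by (simp add: defs m_def)
  qed
  moreover have "card (S \<union> T) + card M \<le> card V - 1"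
  proof -
    \<comment> \<open>For the same reason an edge inside \<open>C\<close> contributes to neither
      \<open>S\<close> nor \<open>T\<close>.\<close>
    have "card (S \<union> T) + card M = card (S \<union> T \<union> M)"
      using fin away(3,4) xs(2,3) by (intro card_Un_disjoint[symmetric]) (auto simp: defs nbrs_def)
    also have "\<dots> \<le> card {..<m - 1}" by (intro card_mono) (auto simp: defs)
    finally show ?thesis using m by simp
  qed
  moreover have "card M + card L = card C"
  proof -
    \<comment> \<open>The path starts outside \<open>C\<close>, so each vertex of \<open>C\<close>
      has a predecessor and is reached by an edge in \<open>M\<close> or \<open>L\<close>.\<close>
    have "\<exists>i. Suc i < m \<and> w = xs ! Suc i" if "w \<in> C" for w
    proof -
      have "w \<in> set xs" "w \<noteq> xs ! 0" using that C(1) xs' away(1) xs(2) by (auto simp: hd_conv_nth)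
      then obtain j where "j < m" "w = xs ! j" "j \<noteq> 0"
        unfolding m_def by (metis in_set_conv_nth)
      then show ?thesis by (metis not0_implies_Suc)
    qed
    then have "(\<lambda>i. xs ! Suc i) ` (M \<union> L) = C" by (fastforce simp: defs)
    moreover have "inj_on (\<lambda>i. xs ! Suc i) (M \<union> L)"
      using xs'(1) by (auto simp: inj_on_def defs m_def nth_eq_iff_index_eq)
    ultimately have "card (M \<union> L) = card C" by (metis card_image)
    moreover have "M \<inter> L = {}" by (auto simp: defs)
    ultimately show ?thesis using fin by (simp add: card_Un_disjoint)
  qed
  moreover have "card R > 0"
  proof -
    define i where "i = Max {i. i < m \<and> xs ! i \<in> C}"
    have "\<exists>i. i < m \<and> xs ! i \<in> C" using C(1,2) xs'(2) by (metis in_set_conv_nth all_not_in_conv m_def subsetD)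
    then have i: "i < m" "xs ! i \<in> C"
      using Max_in[of "{i. i < m \<and> xs ! i \<in> C}"] by (auto simp: i_def)
    have "i \<noteq> m - 1" using away(2) xs(3) xs'(3) i(2) by (auto simp: last_conv_nth m_def)
    then have "Suc i < m" using i by simp
    moreover have "xs ! Suc i \<notin> C"
    proof
      assume "xs ! Suc i \<in> C"
      then have "Suc i \<le> i" unfolding i_def using \<open>Suc i < m\<close>[unfolded i_def] by (intro Max_ge) auto
      then show False by simp
    qed
    ultimately have "i \<in> R" using i by (simp add: defs)
    then show ?thesis using fin by (auto simp: card_gt_0_iff)
  qed
  moreover have "deg u + deg v = card S + card T"
    using deg_hd[OF xs(1)] deg_last[OF xs(1)] xs by (simp add: defs m_def)
  \<comment> \<open>The entries in \<open>F\<close> are paid for by the reduced bound on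
    \<open>S \<inter> T\<close>; the single other entry is absorbed by the \<open>- 1\<close> in the
    bound on \<open>S \<union> T\<close>.\<close>
  ultimately show ?thesis using card_Un_Int[OF fin(1,2)] m \<open>m > 0\<close> by linarith
qed

text \<open>All vertices of \<open>D\<close> have the same neighbours \<open>B\<close> outside
  \<open>D\<close>. The two alternatives arise from whether \<open>D\<close> is a clique; when it is
  not, the bound for the clique \<open>C = V - D - B\<close> forces \<open>B\<close> to contain
  entire neighbourhoods.\<close>

lemma low_degree_structure:
  assumes d: "card F < d" "2 * d < card V + card F"
    and D: "D \<subseteq> V" "card D + card F = d" "\<And>v. v \<in> D \<Longrightarrow> deg v = d"
    and K: "clique (V - D) E"
  obtains B where "B \<subseteq> V - D" "card B = d" "\<And>u. u \<in> D \<Longrightarrow> nbrs E u \<subseteq> B"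
  | B where "B \<subseteq> V - D" "card B = card F + 1" "\<And>u. u \<in> D \<Longrightarrow> nbrs E u \<subseteq> D \<union> B"
proof -
  have finD: "finite D" using D(1) finite_V finite_subset by blast
  have "D \<noteq> {}" using d(1) D(2) by auto
  then obtain u0 where u0: "u0 \<in> D" by blast
  have cardK: "card (V - D) = card V - card D" using D(1) finD by (simp add: card_Diff_subset)
  have cardDV: "card D \<le> card V" using D(1) finite_V by (rule card_mono[rotated])
  \<comment> \<open>A neighbour \<open>w\<close> in \<open>D\<close> raises \<open>deg v\<close> to
    \<open>card (V - D)\<close>, which with \<open>deg u = d\<close> exceeds the degree sum bound by
    one.\<close>
  have all_or_none: "{u, v} \<in> E" if "u \<in> D" "w \<in> D" "v \<in> V - D" "{w, v} \<in> E" for u w v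
  proof (rule ccontr)
    assume "{u, v} \<notin> E"
    then have "deg u + deg v + 1 \<le> card V + card F"
      using that D(1) by (intro deg_sum_le) auto
    moreover have "insert w (V - D - {v}) \<subseteq> nbrs E v"
      using K that by (auto simp: nbrs_def clique_def insert_commute)
    then have "card (insert w (V - D - {v})) \<le> deg v" by (intro card_mono) auto
    then have "card (V - D) \<le> deg v"
      using that finite_V by (simp add: card_insert_if card_Diff_singleton)
    ultimately show False using D(2) D(3)[OF \<open>u \<in> D\<close>] cardK cardDV by linarith
  qed
  define B where "B = nbrs E u0 - D"
  have B: "B \<subseteq> V - D" using nbrs_subset[OF edges_V] by (auto simp: B_def)
  then have finB: "finite B" using finite_V finite_subset by blast
  have nbrs_B: "nbrs E u - D = B" if "u \<in> D" for u
  proof -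
    have "nbrs E x - D \<subseteq> nbrs E y - D" if "x \<in> D" "y \<in> D" for x y
    proof
      fix v assume v: "v \<in> nbrs E x - D"
      then have "v \<in> V - D" using nbrs_subset[OF edges_V] by blast
      then show "v \<in> nbrs E y - D" using v all_or_none[OF that(2,1)] by (simp add: nbrs_def)
    qed
    then show ?thesis using that u0 unfolding B_def by blast
  qed
  have deg_split: "deg u = card (nbrs E u \<inter> D) + card B" if "u \<in> D" for u
    using card_Int_Diff[OF finite_nbrs, of u D] nbrs_B[OF that] by simp
  show ?thesis
  proof (cases "clique D E")
    case True
    \<comment> \<open>Inside the clique \<open>D\<close>, \<open>u0\<close> has
      \<open>d - card F - 1\<close> neighbours, which leaves \<open>card F + 1\<close> for
      \<open>B\<close>.\<close>
    have "nbrs E u0 \<inter> D = D - {u0}"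
      using True u0 nbrs_subset[OF edges_V, of u0] by (auto simp: clique_def nbrs_def)
    then have "card B = card F + 1"
      using deg_split[OF u0] D(3)[OF u0] D(2) d(1) u0 finD by (simp add: card_Diff_singleton)
    moreover have "nbrs E u \<subseteq> D \<union> B" if "u \<in> D" for u using nbrs_B[OF that] by blast
    ultimately show ?thesis using that(2) B by blast
  next
    case False
    then obtain u v where uv: "u \<in> D" "v \<in> D" "u \<noteq> v" "{u, v} \<notin> E" by (auto simp: clique_def)
    define C where "C = V - D - B"
    have cardB: "card B \<le> d" using deg_split[OF u0] D(3)[OF u0] by simp
    have cardC: "card C + card B + card D = card V"
      using B finB cardK cardDV card_mono[of "V - D" B] finite_V by (simp add: C_def card_Diff_subset)
    have away: "nbrs E w \<inter> C = {}" if "w \<in> D" for w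
      using nbrs_B[OF that] by (auto simp: C_def)
    have bdry: "{x \<in> V - C. \<exists>c\<in>C. {x, c} \<in> E} \<subseteq> V - D"
      using away by (fastforce simp: nbrs_def)
    have "deg u + deg v + card C \<le> card V + card F"
    proof (rule deg_sum_clique_le)
      \<comment> \<open>\<open>B\<close> and \<open>D\<close> have together at most
        \<open>2 * d - card F\<close> vertices, fewer than \<open>card V\<close>.\<close>
      show "C \<noteq> {}" using cardC cardB d(2) D(2) by auto
      show "clique C E" using K by (rule smaller_clique) (auto simp: C_def)
      show "clique {x \<in> V - C. \<exists>c\<in>C. {x, c} \<in> E} E" using K bdry by (rule smaller_clique)
    qed (use uv D(1) away in \<open>auto simp: C_def\<close>)
    then have "d \<le> card B" using cardC D(2) D(3) uv by simp
    then have "card B = d" using cardB by simp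
    moreover have "nbrs E w \<subseteq> B" if "w \<in> D" for w
    proof -
      \<comment> \<open>\<open>B\<close> accounts for the whole degree of \<open>w\<close>, so
        \<open>D\<close> is independent.\<close>
      have "card (nbrs E w \<inter> D) = 0" using deg_split[OF that] D(3)[OF that] \<open>card B = d\<close> by simp
      then have "nbrs E w \<inter> D = {}" by simp
      then show ?thesis using nbrs_B[OF that] by blast
    qed
    ultimately show ?thesis using that(1) B by blast
  qed
qed

end

section \<open>Embeddings into the two extremal graphs\<close>

lemma iso_to_H_graph:
  assumes V: "finite V" "E \<subseteq> [V]\<^bsup>2\<^esup>" "card V = n"
    and D: "D \<subseteq> V" "card D + l = d" and B: "B \<subseteq> V - D" "card B = d"
    and nbrs: "\<And>u. u \<in> D \<Longrightarrow> nbrs E u \<subseteq> B"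
  shows "iso_to_subgraph (V, E) (H_graph n d l)"
proof -
  define C where "C = V - D - B"
  have fin: "finite B" "finite C" "finite D"
    using V(1) D(1) B(1) by (auto simp: C_def intro: finite_subset)
  have VU: "V = B \<union> C \<union> D" using D(1) B(1) by (auto simp: C_def)
  have disj: "B \<inter> C = {}" "B \<inter> D = {}" "C \<inter> D = {}" using B(1) by (auto simp: C_def)
  have "card V = card B + card C + card D"
    using fin disj unfolding VU by (simp add: card_Un_disjoint Int_Un_distrib2)
  then have cards: "d + card C = n - d + l" "n - d + l + card D = n"
    using V(3) D(2) B(2) by linarith+
  \<comment> \<open>In the order \<open>B\<close>, \<open>C\<close>, \<open>D\<close> the first two
    blocks fill the big clique, and \<open>B\<close> becomes the common neighbourhood
    \<open>{..<d}\<close>.\<close>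
  obtain f :: "'a \<Rightarrow> nat" where f: "inj_on f V" "f ` B = {..<d}" "f ` C = {d..<n - d + l}"
    "f ` D = {n - d + l..<n}"
    using bij_to_intervals[OF fin disj] unfolding VU B(2) cards by metis
  have fK: "f x < n - d + l" if "x \<in> B \<union> C" for x
  proof -
    have "f x \<in> {..<d} \<union> {d..<n - d + l}" using that imageI[of x _ f] f(2,3) by blast
    then show ?thesis using cards(1) by auto
  qed
  have "f ` e \<in> edges (H_graph n d l)" if eE: "e \<in> E" for e
  proof -
    have "e \<in> [V]\<^bsup>2\<^esup>" using eE V(2) by blast
    then obtain x y where e: "e = {x, y}" "x \<in> V" "y \<in> V" "x \<noteq> y"
      by (auto simp: nsets_def card_2_iff)
    have DB: ?thesis if "x \<in> D" "y \<in> V" "e = {x, y}" for x y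
    proof -
      have "y \<in> B" using nbrs[OF that(1)] eE that(3) by (auto simp: nbrs_def)
      then have "f y \<in> {..<d}" "f x \<in> {n - d + l..<n}" using f(2,4) that(1) by blast+
      moreover have "f ` e = {f y, f x}" using that(3) by auto
      ultimately have "f ` e \<in> {{u, v} |u v. u \<in> {..<d} \<and> v \<in> {n - d + l..<n}}" by blast
      then show ?thesis by (simp add: H_graph_def)
    qed
    show ?thesis
    proof (cases "x \<in> D \<or> y \<in> D")
      case True
      then show ?thesis
      proof
        assume "x \<in> D" then show ?thesis using DB[of x y] e by blast
      next
        assume "y \<in> D" then show ?thesis using DB[of y x] e by blast
      qed
    next
      case False
      then have "x \<in> B \<union> C" "y \<in> B \<union> C" using e(2,3) VU by blast+
      moreover have "f x \<noteq> f y" using inj_onD[OF f(1)] e by blast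
      ultimately have "f ` e \<in> [{..<n - d + l}]\<^bsup>2\<^esup>"
        using fK[of x] fK[of y] e(1) by (simp add: nsets_def)
      then show ?thesis by (simp add: H_graph_def)
    qed
  qed
  moreover have "f ` V \<subseteq> verts (H_graph n d l)"
    using cards unfolding VU image_Un f(2-4) by (auto simp: H_graph_def)
  ultimately show ?thesis
    unfolding iso_to_subgraph_def subgraph_def using f(1) by (intro exI[of _ f]) auto
qed

text \<open>Numbering in the order \<open>C\<close>, \<open>B\<close>, \<open>D\<close> makes
  \<open>B\<close> the overlap of the two cliques, and each edge stays within
  \<open>C \<union> B\<close> or \<open>D \<union> B\<close>.\<close>

lemma iso_to_H'_graph:
  assumes V: "finite V" "E \<subseteq> [V]\<^bsup>2\<^esup>" "card V = n"
    and D: "D \<subseteq> V" "card D + l = d" and B: "B \<subseteq> V - D" "card B = l + 1"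
    and nbrs: "\<And>u. u \<in> D \<Longrightarrow> nbrs E u \<subseteq> D \<union> B"
  shows "iso_to_subgraph (V, E) (H'_graph n d l)"
proof -
  define C where "C = V - D - B"
  have fin: "finite B" "finite C" "finite D"
    using V(1) D(1) B(1) by (auto simp: C_def intro: finite_subset)
  have VU: "V = C \<union> B \<union> D" using D(1) B(1) by (auto simp: C_def)
  have disj: "C \<inter> B = {}" "C \<inter> D = {}" "B \<inter> D = {}" using B(1) by (auto simp: C_def)
  have "card V = card C + card B + card D"
    using fin disj unfolding VU by (simp add: card_Un_disjoint Int_Un_distrib2)
  then have cards: "card C = n - d - 1" "n - d - 1 + card B = n - d + l" "n - d + l + card D = n"
    using V(3) D(2) B(2) by linarith+
  obtain f :: "'a \<Rightarrow> nat" where f: "inj_on f V" "f ` C = {..<n - d - 1}"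
    "f ` B = {n - d - 1..<n - d + l}" "f ` D = {n - d + l..<n}"
    using bij_to_intervals[OF fin(2,1,3) disj] unfolding VU cards by metis
  have fK: "f x < n - d + l" if "x \<in> C \<union> B" for x
  proof -
    have "f x \<in> {..<n - d - 1} \<union> {n - d - 1..<n - d + l}" using that imageI[of x _ f] f(2,3) by blast
    then show ?thesis using cards by auto
  qed
  have fDB: "n - d - 1 \<le> f x \<and> f x < n" if "x \<in> D \<union> B" for x
  proof -
    have "f x \<in> {n - d + l..<n} \<union> {n - d - 1..<n - d + l}" using that imageI[of x _ f] f(3,4) by blast
    then show ?thesis using cards by auto
  qed
  have "f ` e \<in> edges (H'_graph n d l)" if eE: "e \<in> E" for e
  proof -
    have "e \<in> [V]\<^bsup>2\<^esup>" using eE V(2) by blast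
    then obtain x y where e: "e = {x, y}" "x \<in> V" "y \<in> V" "x \<noteq> y"
      by (auto simp: nsets_def card_2_iff)
    have "f x \<noteq> f y" using inj_onD[OF f(1)] e by blast
    have "x \<in> D \<Longrightarrow> y \<in> D \<union> B" "y \<in> D \<Longrightarrow> x \<in> D \<union> B"
      using nbrs[of x] nbrs[of y] eE e(1) by (auto simp: nbrs_def insert_commute)
    then consider "x \<in> D \<union> B" "y \<in> D \<union> B" | "x \<in> C \<union> B" "y \<in> C \<union> B"
      using e VU by blast
    then show ?thesis
    proof cases
      case 1
      then have "f ` e \<in> [{n - d - 1..<n}]\<^bsup>2\<^esup>"
        using fDB[of x] fDB[of y] e(1) \<open>f x \<noteq> f y\<close> by (simp add: nsets_def)
      then show ?thesis by (simp add: H'_graph_def)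
    next
      case 2
      then have "f ` e \<in> [{..<n - d + l}]\<^bsup>2\<^esup>"
        using fK[of x] fK[of y] e(1) \<open>f x \<noteq> f y\<close> by (simp add: nsets_def)
      then show ?thesis by (simp add: H'_graph_def)
    qed
  qed
  moreover have "f ` V \<subseteq> verts (H'_graph n d l)"
    using cards unfolding VU image_Un f(2-4) by (auto simp: H'_graph_def)
  ultimately show ?thesis
    unfolding iso_to_subgraph_def subgraph_def using f(1) by (intro exI[of _ f]) auto
qed

section \<open>Passage to an edge-maximal graph, and the conclusion for \<open>G\<close>\<close>

lemma iso_to_subgraph_mono:
  assumes "iso_to_subgraph (V, E') H" "E \<subseteq> E'"
  shows "iso_to_subgraph (V, E) H"
  using assms(1)[unfolded iso_to_subgraph_def subgraph_def fst_conv snd_conv]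
proof (elim exE conjE)
  fix f assume f: "inj_on f V" "f ` V \<subseteq> verts H" "(\<lambda>e. f ` e) ` E' \<subseteq> edges H"
  have "(\<lambda>e. f ` e) ` E \<subseteq> edges H" using image_mono[OF assms(2)] f(3) by (rule subset_trans)
  then show ?thesis
    unfolding iso_to_subgraph_def subgraph_def fst_conv snd_conv
    using f(1,2) by (intro exI[of _ f] conjI)
qed

text \<open>There are finitely many edge sets on \<open>V\<close>, so a maximal one without a
  hamiltonian cycle through \<open>F\<close> exists above \<open>E0\<close>. Adding a missing edge
  creates such a cycle, which must use that edge.\<close>

lemma obtain_saturation:
  assumes V: "finite V" "3 \<le> card V" and E0: "E0 \<subseteq> [V]\<^bsup>2\<^esup>"
    and F: "linear_forest F" "verts F \<subseteq> V" "edges F \<subseteq> E0"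
    and no: "\<nexists>C. hamiltonian_cycle (V, E0) C \<and> edges F \<subseteq> edges C"
  obtains E where "E0 \<subseteq> E" "forest_saturated V E (edges F)" "\<not> clique V E"
proof -
  define free where "free E \<longleftrightarrow> E0 \<subseteq> E \<and> E \<subseteq> [V]\<^bsup>2\<^esup> \<and>
    (\<nexists>xs. distinct xs \<and> set xs = V \<and> cycle_edges xs \<subseteq> E \<and> edges F \<subseteq> cycle_edges xs)" for E
  have len: "3 \<le> length xs" if "distinct xs" "set xs = V" for xs
    using that V(2) distinct_card[of xs] by simp
  have "free E0"
  proof -
    have False if xs: "distinct xs" "set xs = V" "cycle_edges xs \<subseteq> E0" "edges F \<subseteq> cycle_edges xs" for xs
    proof -
      have "is_cycle (set xs, cycle_edges xs)"
        unfolding is_cycle_def cycle_edges_def using xs(1) len[OF xs(1,2)] by blast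
      then have "hamiltonian_cycle (V, E0) (set xs, cycle_edges xs)"
        using xs by (simp add: hamiltonian_cycle_def subgraph_def)
      then show False using no xs(4) by (metis snd_conv)
    qed
    then show ?thesis using E0 unfolding free_def by blast
  qed
  then have "E0 \<in> {E. free E}" by (rule CollectI)
  moreover have "finite {E. free E}"
  proof (rule finite_subset)
    show "{E. free E} \<subseteq> Pow ([V]\<^bsup>2\<^esup>)" unfolding free_def by blast
  qed (simp add: V(1) finite_imp_finite_nsets)
  ultimately obtain E where "E \<in> {E. free E}" and "\<forall>E'\<in>{E. free E}. E \<subseteq> E' \<longrightarrow> E = E'"
    using finite_has_maximal2[of "{E. free E}" E0] by metis
  then have "free E" and max: "\<And>E'. free E' \<Longrightarrow> E \<subseteq> E' \<Longrightarrow> E = E'"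
    by simp_all
  then have E: "E0 \<subseteq> E" "E \<subseteq> [V]\<^bsup>2\<^esup>" unfolding free_def by blast+
  have no_cycle: "\<not> edges F \<subseteq> cycle_edges xs"
    if "distinct xs" "set xs = V" "cycle_edges xs \<subseteq> E" for xs
    using \<open>free E\<close> that unfolding free_def by blast
  have "forest_saturated V E (edges F)"
  proof
    show "finite V" "E \<subseteq> [V]\<^bsup>2\<^esup>" using V(1) E by blast+
    show "finite (edges F)"
      using F(3) E0 finite_imp_finite_nsets[OF V(1)] by (meson finite_subset)
    show "\<not> edges F \<subseteq> cycle_edges xs" if "distinct xs" "set xs = V" "cycle_edges xs \<subseteq> E" for xs
      using that by (rule no_cycle)
    fix u v assume uv: "u \<in> V" "v \<in> V" "u \<noteq> v" "{u, v} \<notin> E"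
    then have "\<not> free (insert {u, v} E)" using max[of "insert {u, v} E"] by blast
    moreover have "E0 \<subseteq> insert {u, v} E" "insert {u, v} E \<subseteq> [V]\<^bsup>2\<^esup>"
      using E uv by (auto simp: nsets_def)
    ultimately obtain xs where xs: "distinct xs" "set xs = V" "cycle_edges xs \<subseteq> insert {u, v} E"
      "edges F \<subseteq> cycle_edges xs" unfolding free_def by blast
    have "{u, v} \<in> cycle_edges xs" using no_cycle[of xs] xs by blast
    moreover have "xs \<noteq> []" using xs(2) uv(1) by auto
    ultimately obtain ys where ys: "distinct ys" "set ys = set xs"
      "cycle_edges ys = cycle_edges xs" "hd ys = u" "last ys = v"
      using cycle_edge_as_path_ends[OF xs(1) _ _ uv(3)] by blast
    have cyc: "cycle_edges xs = insert {u, v} (path_edges ys)"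
      unfolding ys(3)[symmetric] by (simp add: cycle_edges_def ys(4,5) insert_commute)
    \<comment> \<open>With three or more vertices the ends are not consecutive, so
      \<open>{u, v}\<close> occurs only as the closing edge and the path itself lies in
      \<open>E\<close>.\<close>
    have "3 \<le> length ys" using len[OF ys(1)] ys(2) xs(2) by blast
    then have "ys \<noteq> []" by auto
    then have ends: "ys ! 0 = u" "ys ! (length ys - 1) = v"
      using ys(4,5) by (metis hd_conv_nth, metis last_conv_nth)
    have "length ys - 1 = Suc 0" if "{u, v} \<in> path_edges ys"
      using nth_path_edgeD[OF ys(1), of 0 "length ys - 1", unfolded ends] that \<open>3 \<le> length ys\<close>
      by linarith
    then have "{u, v} \<notin> path_edges ys" using \<open>3 \<le> length ys\<close> by auto
    moreover have "{u, v} \<notin> edges F" using F(3) E(1) uv(4) by blast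
    ultimately have "path_edges ys \<subseteq> E" "edges F \<subseteq> path_edges ys" using xs(3,4) unfolding cyc by blast+
    then show "\<exists>xs. distinct xs \<and> set xs = V \<and> path_edges xs \<subseteq> E \<and> edges F \<subseteq> path_edges xs \<and>
        hd xs = u \<and> last xs = v"
      using ys xs(2) by blast
  qed
  moreover have "\<not> clique V E"
  proof
    assume "clique V E"
    have "[V]\<^bsup>2\<^esup> \<subseteq> E"
    proof
      fix e assume "e \<in> [V]\<^bsup>2\<^esup>"
      then obtain x y where "e = {x, y}" "x \<in> V" "y \<in> V" "x \<noteq> y"
        by (auto simp: nsets_def card_2_iff)
      then show "e \<in> E" using \<open>clique V E\<close> by (simp add: clique_def)
    qed
    obtain xs where xs: "distinct xs" "set xs = V" "edges F \<subseteq> path_edges xs"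
      using linear_forest_in_path[OF F(1,2) V(1)] by metis
    have "cycle_edges xs \<subseteq> [V]\<^bsup>2\<^esup>"
      using cycle_edges_subset_nsets[of xs] xs len[of xs] by simp
    then have "cycle_edges xs \<subseteq> E" using \<open>[V]\<^bsup>2\<^esup> \<subseteq> E\<close> by (rule subset_trans)
    moreover have "edges F \<subseteq> cycle_edges xs" using xs(3) unfolding cycle_edges_def by blast
    ultimately show False using no_cycle[OF xs(1,2)] by blast
  qed
  ultimately show ?thesis using that E(1) by blast
qed

theorem theorem5:
  fixes G :: "'a graph" and n r d l :: nat
  assumes "n \<ge> 3" and "r \<ge> 2" and "l < d" and "d \<le> (n + l - 1) div 2"
    and "simple_graph G" and "card (verts G) = n"
    and "\<not> l_hamiltonian l G"
    and "min_degree G \<ge> d"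
    and "num_cliques G r > max (h r n (d + 1) l) (h r n ((n + l - 1) div 2) l)"
  shows "iso_to_subgraph G (H_graph n d l) \<or> iso_to_subgraph G (H'_graph n d l)"
proof -
  \<comment> \<open>This is the largest \<open>k\<close> with \<open>2 * k + 1 \<le> n + l\<close>,
    the range left by the degree sum bound.\<close>
  define m where "m = (n + l - 1) div 2"
  obtain V E0 where G: "G = (V, E0)" by (cases G)
  have V: "finite V" "E0 \<subseteq> [V]\<^bsup>2\<^esup>" "card V = n" using assms(5,6) by (auto simp: G simple_graph_def)
  obtain F where F: "linear_forest F" "subgraph F G" "card (edges F) = l"
    "\<nexists>C. hamiltonian_cycle G C \<and> edges F \<subseteq> edges C"
    using assms(7) unfolding l_hamiltonian_def by blast
  obtain E where E: "E0 \<subseteq> E" "forest_saturated V E (edges F)" "\<not> clique V E"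
    using obtain_saturation[of V E0 F] F V assms(1) by (auto simp: G subgraph_def)
  interpret forest_saturated V E "edges F" by (rule E(2))
  have min_deg: "d \<le> deg v" if "v \<in> V" for v
  proof -
    have "min_degree G \<le> degree G v"
      unfolding min_degree_def G using V(1) that by (intro Min_le) auto
    with assms(8) have "d \<le> degree G v" by simp
    also have "\<dots> = card (nbrs E0 v)" using V(2) by (simp add: G degree_eq_card_nbrs)
    also have "\<dots> \<le> deg v" using E(1) by (intro card_mono finite_nbrs) (auto simp: nbrs_def)
    finally show ?thesis .
  qed
  have many: "h r n (d + 1) l < num_cliques (V, E) r" "h r n m l < num_cliques (V, E) r"
    using assms(9) num_cliques_mono[OF V(1) E(1), of r] by (simp_all add: G m_def)
  have "m \<le> n" using assms(3,4) unfolding m_def by linarith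
  have few: "num_cliques (V, E) r \<le> h r n k l"
    if "D \<subseteq> V" "k \<le> card D + l" "\<And>v. v \<in> D \<Longrightarrow> deg v \<le> k" "d \<le> k" "k \<le> m" for D k
    using that assms(3) \<open>m \<le> n\<close> V by (intro num_cliques_le_h[OF finite_V edges_V]) auto
  \<comment> \<open>Convexity bounds \<open>h r n k l\<close> by its values at \<open>d + 1\<close>
    and \<open>m\<close>, both below the clique count.\<close>
  have high: False if "D \<subseteq> V" "k \<le> card D + l" "\<And>v. v \<in> D \<Longrightarrow> deg v \<le> k" "d + 1 \<le> k" "k \<le> m" for D k
    using few[of D k] h_le_max[of r l "d + 1" k m n] that many assms(2,3) \<open>m \<le> n\<close>
    by (auto simp: max_def split: if_splits)
  have le_m: "k \<le> m" if "2 * k + 1 \<le> card V + card (edges F)" for k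
    using that V(3) F(3) unfolding m_def by linarith
  define D where "D = {v \<in> V. deg v \<le> d}"
  have D: "D \<subseteq> V" "\<And>v. v \<in> D \<Longrightarrow> deg v = d" using min_deg by (auto simp: D_def intro: le_antisym)
  have "d \<le> card D + l \<and> d < m"
  proof -
    obtain u v where uv: "u \<in> V" "v \<in> V" "u \<noteq> v" "{u, v} \<notin> E" using E(3) by (auto simp: clique_def)
    obtain k D' where k: "d \<le> k" "2 * k + 1 \<le> card V + card (edges F)" "D' \<subseteq> V"
      "k \<le> card D' + card (edges F)" "\<And>w. w \<in> D' \<Longrightarrow> deg w \<le> k"
      using many_low_degree_vertices[OF uv min_deg[OF uv(1)] min_deg[OF uv(2)]] by metis
    \<comment> \<open>A larger \<open>k\<close> is excluded by \<open>high\<close>. If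
      \<open>d\<close> were \<open>m\<close>, the clique bound for \<open>D'\<close> would
      contradict the hypothesis at \<open>m\<close>.\<close>
    have "k = d" using high[of D' k] k le_m[of k] F(3) by fastforce
    then have "D' \<subseteq> D" using k(3,5) by (auto simp: D_def)
    then have "card D' \<le> card D" using D(1) V(1) by (meson card_mono finite_subset)
    moreover have "d \<noteq> m" using few[of D' k] k le_m[of k] F(3) many(2) \<open>k = d\<close> by auto
    ultimately show ?thesis using k \<open>k = d\<close> F(3) le_m[of k] by auto
  qed
  \<comment> \<open>As \<open>d < m\<close>, the value \<open>k = d + 1\<close> is admissible in
    \<open>high\<close>, and a larger \<open>D\<close> would itself be excluded there.\<close>
  moreover have "\<not> d + 1 \<le> card D + l" using high[of D "d + 1"] D calculation by fastforce
  ultimately have cardD: "card D + l = d" by linarith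
  \<comment> \<open>A non-adjacent pair outside \<open>D\<close> has degrees at least
    \<open>d + 1\<close> and so yields some \<open>k > d\<close>, against
    \<open>high\<close>.\<close>
  have "clique (V - D) E"
  proof (rule ccontr)
    assume "\<not> clique (V - D) E"
    then obtain u v where "u \<in> V - D" "v \<in> V - D" "u \<noteq> v" "{u, v} \<notin> E"
      unfolding clique_def by blast
    then have uv: "u \<in> V" "v \<in> V" "u \<noteq> v" "{u, v} \<notin> E" "d + 1 \<le> deg u" "d + 1 \<le> deg v"
      by (simp_all add: D_def Suc_le_eq not_le)
    obtain k D' where "d + 1 \<le> k" "2 * k + 1 \<le> card V + card (edges F)" "D' \<subseteq> V"
      "k \<le> card D' + card (edges F)" "\<And>w. w \<in> D' \<Longrightarrow> deg w \<le> k"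
      using many_low_degree_vertices[OF uv] by metis
    then show False using high[of D' k] le_m[of k] F(3) by auto
  qed
  moreover have "2 * d < card V + card (edges F)" using assms(1,4) V(3) F(3) by linarith
  ultimately have "iso_to_subgraph (V, E) (H_graph n d l) \<or> iso_to_subgraph (V, E) (H'_graph n d l)"
    using low_degree_structure[of d D] D cardD F(3) assms(3) iso_to_H_graph[OF finite_V edges_V V(3) D(1) cardD]
      iso_to_H'_graph[OF finite_V edges_V V(3) D(1) cardD] by metis
  then show ?thesis using iso_to_subgraph_mono[OF _ E(1)] unfolding G by blast
qed

end
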